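(* Let $G_1,\ldots,G_n$ be nondeterministic automata, where $G_i$ has state set $Q_i$ and set of secret states $Q_i^S$, and consider the composed system $G_1\|\cdots\|G_n$ with interaction $\|_\lor$, i.e. with set of secret states $Q^S=Q\setminus(Q_1^{NS}\times\cdots\times Q_n^{NS})$ where $Q=Q_1\times\cdots\times Q_n$ and $Q_i^{NS}=Q_i\setminus Q_i^S$. Let $det(G_i)=\langle\Sigma_i,X^i_{obs},\to_i,X_i^\circ\rangle$ be the current-state estimator of $G_i$, $1\le i\le n$. Then $G_1\|\cdots\|G_n$ is current-state opaque if and only if, for every string $s$, $det(G_1)\|\cdots\|det(G_n)\stackrel{s}{\to}(X_1,\ldots,X_n)$ implies $X_i\not\subseteq Q_i^S$ for all $1\le i\le n$.
   Context: An automaton is $G=\langle\Sigma_\tau,Q,\to,Q^\circ\rangle$ with finite set $\Sigma$ of observable events, a special unobservable event $\tau\notin\Sigma$, $\Sigma_\tau=\Sigma\cup\{\tau\}$, finite state set $Q$, transition relation $\to\subseteq Q\times\Sigma_\tau\times Q$, initial states $Q^\circ$; it carries a set of secret states $Q^S\subseteq Q$. For $s\in\Sigma^*$, $p\stackrel{s}{\Rightarrow}q$ means there is $t\in\Sigma_\tau^*$ which becomes $s$ after deleting all $\tau$'s and $p\stackrel{t}{\to}q$; $L(G,q)=\{s\in\Sigma^*: q\stackrel{s}{\Rightarrow}q'\text{ for some }q'\}$. Synchronous composition: states are tuples, initial states products of initial states; an event shared by components (events in $\Sigma$ only; $\tau$ is never shared) is executed jointly by all components having it in their alphabet, other events (including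 $\tau$) are executed by a single component while the others stay put. Current-state opacity: $G$ is current-state opaque w.r.t. $Q^S$ iff for every $q^\circ\in Q^\circ$ and every $s\in L(G,q^\circ)$ with $q^\circ\stackrel{s}{\Rightarrow}Q^S$ there is $q'^\circ\in Q^\circ$ with $q'^\circ\stackrel{s}{\Rightarrow}Q\setminus Q^S$. Current-state estimator (observer): for $B\subseteq Q$, $UR(B)$ is the set of states reachable from $B$ by strings in $\{\tau\}^*$. $det(G)=\langle\Sigma,X_{obs},\to_{obs},X^\circ_{obs}\rangle$ is the deterministic automaton with initial state $X^\circ_{obs}=UR(Q^\circ)$ and transitions $X\stackrel{\sigma}{\to}_{obs}Y$ for $\sigma\in\Sigma$, where $Y=\bigcup\{UR(\{y\}): x\stackrel{\sigma}{\to}y,\ x\in X\}$ is nonempty; $X_{obs}\subseteq 2^Q$ consists of the states reachable from $X^\circ_{obs}$. Compositions of estimators are synchronous compositions of these deterministic automata.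
   Formalization: If some G_i has no initial state, the estimator det(G_i) is taken to have no initial state instead of the initial state ∅; with the literal UR(∅)=∅ the equivalence fails, since the system is vacuously opaque while ∅ ⊆ Q_i^S. *)

theory Defs
  imports Main "HOL-Library.FuncSet"
begin

text \<open>
  Labels have type \<^typ>\<open>'e option\<close>: \<^term>\<open>Some \<sigma>\<close> is the observable event \<open>\<sigma>\<close> and
  \<^term>\<open>None\<close> is the unobservable event \<open>\<tau>\<close>. The field \<open>alphabet\<close> is \<open>\<Sigma>\<close>, without \<open>\<tau>\<close>.
\<close>

record ('e, 'q) automaton =
  alphabet :: "'e set"
  states :: "'q set"
  transitions :: "('q \<times> 'e option \<times> 'q) set"
  initials :: "'q set"

definition wf_automaton :: "('e, 'q) automaton \<Rightarrow> bool" where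
  "wf_automaton G \<longleftrightarrow>
     finite (alphabet G) \<and> finite (states G) \<and>
     transitions G \<subseteq> states G \<times> insert None (Some ` alphabet G) \<times> states G \<and>
     initials G \<subseteq> states G"

primrec run :: "('e, 'q) automaton \<Rightarrow> 'q \<Rightarrow> 'e option list \<Rightarrow> 'q \<Rightarrow> bool" where
  "run G p [] q \<longleftrightarrow> p = q"
| "run G p (a # t) q \<longleftrightarrow> (\<exists>r. (p, a, r) \<in> transitions G \<and> run G r t q)"

definition observation :: "'e option list \<Rightarrow> 'e list" where
  "observation t = map the (filter (\<lambda>a. a \<noteq> None) t)"

definition weak_run :: "('e, 'q) automaton \<Rightarrow> 'q \<Rightarrow> 'e list \<Rightarrow> 'q \<Rightarrow> bool" where
  "weak_run G p s q \<longleftrightarrow> (\<exists>t. observation t = s \<and> run G p t q)"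

definition language :: "('e, 'q) automaton \<Rightarrow> 'q \<Rightarrow> 'e list set" where
  "language G q = {s \<in> lists (alphabet G). \<exists>q'. weak_run G q s q'}"

definition current_state_opaque :: "('e, 'q) automaton \<Rightarrow> 'q set \<Rightarrow> bool" where
  "current_state_opaque G S \<longleftrightarrow>
     (\<forall>p \<in> initials G. \<forall>s \<in> language G p.
        (\<exists>q \<in> S. weak_run G p s q) \<longrightarrow>
        (\<exists>p' \<in> initials G. \<exists>q' \<in> states G - S. weak_run G p' s q'))"

text \<open>
  The composition of \<open>G 1, \<dots>, G n\<close>; a tuple of states is an extensional function on \<open>{1..n}\<close>.
  An event that lies in a single alphabet is covered by the first set of transitions.
\<close>

definition sync :: "nat \<Rightarrow> (nat \<Rightarrow> ('e, 'q) automaton) \<Rightarrow> ('e, nat \<Rightarrow> 'q) automaton" where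
  "sync n G =
     \<lparr> alphabet = (\<Union>i\<in>{1..n}. alphabet (G i)),
       states = (\<Pi>\<^sub>E i\<in>{1..n}. states (G i)),
       transitions =
         {(x, Some \<sigma>, y) | x \<sigma> y.
            x \<in> (\<Pi>\<^sub>E i\<in>{1..n}. states (G i)) \<and> y \<in> (\<Pi>\<^sub>E i\<in>{1..n}. states (G i)) \<and>
            \<sigma> \<in> (\<Union>i\<in>{1..n}. alphabet (G i)) \<and>
            (\<forall>i\<in>{1..n}. if \<sigma> \<in> alphabet (G i) then (x i, Some \<sigma>, y i) \<in> transitions (G i)
                        else y i = x i)}
         \<union>
         {(x, None, y) | x y.
            x \<in> (\<Pi>\<^sub>E i\<in>{1..n}. states (G i)) \<and> y \<in> (\<Pi>\<^sub>E i\<in>{1..n}. states (G i)) \<and>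
            (\<exists>i\<in>{1..n}. (x i, None, y i) \<in> transitions (G i) \<and>
                        (\<forall>j\<in>{1..n} - {i}. y j = x j))},
       initials = (\<Pi>\<^sub>E i\<in>{1..n}. initials (G i)) \<rparr>"

definition secret_or ::
  "nat \<Rightarrow> (nat \<Rightarrow> ('e, 'q) automaton) \<Rightarrow> (nat \<Rightarrow> 'q set) \<Rightarrow> (nat \<Rightarrow> 'q) set" where
  "secret_or n G S =
     (\<Pi>\<^sub>E i\<in>{1..n}. states (G i)) - (\<Pi>\<^sub>E i\<in>{1..n}. states (G i) - S i)"

definition unobservable_reach :: "('e, 'q) automaton \<Rightarrow> 'q set \<Rightarrow> 'q set" where
  "unobservable_reach G B = {q. \<exists>p \<in> B. \<exists>t \<in> lists {None}. run G p t q}"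

definition obs_succ :: "('e, 'q) automaton \<Rightarrow> 'q set \<Rightarrow> 'e \<Rightarrow> 'q set" where
  "obs_succ G X \<sigma> =
     \<Union> {unobservable_reach G {y} | x y. x \<in> X \<and> (x, Some \<sigma>, y) \<in> transitions G}"

text \<open>
  The empty set is never an estimator state. For transitions this is the explicit nonemptiness
  condition; for the initial state it only matters when \<open>G\<close> has no initial state at all, in which
  case the estimator has none either (see \<open>initials_det\<close> below for the usual case).
\<close>

inductive_set obs_states :: "('e, 'q) automaton \<Rightarrow> 'q set set" for G where
  initial: "unobservable_reach G (initials G) \<noteq> {} \<Longrightarrow>
    unobservable_reach G (initials G) \<in> obs_states G"
| step: "X \<in> obs_states G \<Longrightarrow> \<sigma> \<in> alphabet G \<Longrightarrow> obs_succ G X \<sigma> \<noteq> {} \<Longrightarrow>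
    obs_succ G X \<sigma> \<in> obs_states G"

definition det :: "('e, 'q) automaton \<Rightarrow> ('e, 'q set) automaton" where
  "det G =
     \<lparr> alphabet = alphabet G,
       states = obs_states G,
       transitions = {(X, Some \<sigma>, Y) | X \<sigma> Y.
         X \<in> obs_states G \<and> \<sigma> \<in> alphabet G \<and> Y = obs_succ G X \<sigma> \<and> Y \<noteq> {}},
       initials = {unobservable_reach G (initials G)} - {{}} \<rparr>"

lemma subset_unobservable_reach: "B \<subseteq> unobservable_reach G B"
proof
  fix q assume "q \<in> B"
  moreover have "run G q [] q" by simp
  ultimately show "q \<in> unobservable_reach G B"
    unfolding unobservable_reach_def by blast
qed

lemma initials_det:
  assumes "initials G \<noteq> {}"
  shows "initials (det G) = {unobservable_reach G (initials G)}"
  using assms subset_unobservable_reach[of "initials G" G] by (auto simp: det_def)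

lemma run_in_states:
  assumes "wf_automaton G" "p \<in> states G" "run G p t q"
  shows "q \<in> states G"
  using assms(2,3)
proof (induction t arbitrary: p)
  case (Cons a t)
  then show ?case using assms(1) unfolding wf_automaton_def by fastforce
qed simp

lemma obs_states_subset:
  assumes "wf_automaton G"
  shows "obs_states G \<subseteq> Pow (states G)"
proof
  fix X assume "X \<in> obs_states G"
  then show "X \<in> Pow (states G)"
  proof cases
    case initial
    then show ?thesis using assms run_in_states[OF assms]
      unfolding unobservable_reach_def wf_automaton_def by blast
  next
    case (step Z \<sigma>)
    have "y \<in> states G" if "(x, Some \<sigma>, y) \<in> transitions G" for x y
      using that assms unfolding wf_automaton_def by blast
    then show ?thesis using step run_in_states[OF assms]
      unfolding obs_succ_def unobservable_reach_def by blast
  qed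
qed

lemma wf_det:
  assumes "wf_automaton G"
  shows "wf_automaton (det G)"
proof -
  have "finite (obs_states G)"
    using obs_states_subset[OF assms] assms
    by (meson finite_Pow_iff finite_subset wf_automaton_def)
  then show ?thesis using assms
    by (auto simp: wf_automaton_def det_def intro: obs_states.intros)
qed

lemma wf_sync:
  assumes "\<And>i. i \<in> {1..n} \<Longrightarrow> wf_automaton (G i)"
  shows "wf_automaton (sync n G)"
proof -
  have "finite (\<Pi>\<^sub>E i\<in>{1..n}. states (G i))"
    using assms by (intro finite_PiE) (auto simp: wf_automaton_def)
  moreover have "(\<Pi>\<^sub>E i\<in>{1..n}. initials (G i)) \<subseteq> (\<Pi>\<^sub>E i\<in>{1..n}. states (G i))"
    using assms by (intro PiE_mono) (auto simp: wf_automaton_def)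
  moreover have "finite (\<Union>i\<in>{1..n}. alphabet (G i))"
    using assms by (auto simp: wf_automaton_def)
  ultimately show ?thesis unfolding wf_automaton_def sync_def by auto
qed

end

theory Submission imports Defs begin

text \<open>
  The estimate after observing \<open>s\<close>, i.e. the set of states reachable by \<open>s\<close> from the initial states,
  is computed by iterating \<^const>\<open>obs_succ\<close>. On a product of \<open>\<tau>\<close>-closed sets, the successor
  operator of the composition acts componentwise, so the estimate of the composition is the product
  of the components reached by the composed estimators. A nonempty product meets the product of the
  nonsecret sets iff each factor does.
\<close>

section \<open>Unobservable reach as an image under a closure\<close>

definition tau_steps :: "('e, 'q) automaton \<Rightarrow> ('q \<times> 'q) set" where
  "tau_steps G = {(p, q). (p, None, q) \<in> transitions G}"

definition event_image :: "('e, 'q) automaton \<Rightarrow> 'q set \<Rightarrow> 'e \<Rightarrow> 'q set" where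
  "event_image G X \<sigma> = {y. \<exists>x\<in>X. (x, Some \<sigma>, y) \<in> transitions G}"

text \<open>Trading \<tau>-strings for a reflexive-transitive closure makes \<open>Image\<close>,
  transitivity and path induction available.\<close>

lemma run_tau_iff: "(\<exists>t \<in> lists {None}. run G p t q) \<longleftrightarrow> (p, q) \<in> (tau_steps G)\<^sup>*"
proof
  assume "\<exists>t \<in> lists {None}. run G p t q"
  then obtain t where "t \<in> lists {None}" "run G p t q" by blast
  then show "(p, q) \<in> (tau_steps G)\<^sup>*"
  proof (induction t arbitrary: p)
    case (Cons a t)
    then obtain r where "(p, r) \<in> tau_steps G" "(r, q) \<in> (tau_steps G)\<^sup>*"
      by (auto simp: tau_steps_def)
    then show ?case by (rule converse_rtrancl_into_rtrancl)
  qed simp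
next
  assume "(p, q) \<in> (tau_steps G)\<^sup>*"
  then show "\<exists>t \<in> lists {None}. run G p t q"
  proof (induction rule: converse_rtrancl_induct)
    case base
    show ?case by (rule bexI[of _ "[]"]) auto
  next
    case (step p r)
    then obtain t where "t \<in> lists {None}" "run G r t q" by blast
    with step(1) show ?case by (intro bexI[of _ "None # t"]) (auto simp: tau_steps_def)
  qed
qed

lemma unobservable_reach_eq_Image: "unobservable_reach G B = (tau_steps G)\<^sup>* `` B"
  unfolding unobservable_reach_def run_tau_iff by blast

lemma unobservable_reach_idem:
  "unobservable_reach G (unobservable_reach G B) = unobservable_reach G B"
  unfolding unobservable_reach_eq_Image by (auto intro: rtrancl_trans)

lemma unobservable_reach_subset_states:
  assumes "wf_automaton G" "B \<subseteq> states G"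
  shows "unobservable_reach G B \<subseteq> states G"
  using assms run_in_states[OF assms(1)] unfolding unobservable_reach_def by blast

text \<open>Images distribute over unions, so closing each successor separately equals closing the
  whole set of successors once.\<close>

lemma obs_succ_eq: "obs_succ G X \<sigma> = unobservable_reach G (event_image G X \<sigma>)"
  unfolding obs_succ_def event_image_def unobservable_reach_eq_Image by blast

lemma obs_succ_empty: "obs_succ G {} \<sigma> = {}"
  by (simp add: obs_succ_def)

lemma event_image_subset_states: "wf_automaton G \<Longrightarrow> event_image G X \<sigma> \<subseteq> states G"
  unfolding event_image_def wf_automaton_def by blast

section \<open>Weak runs as iterated estimates\<close>

lemma weak_run_Nil_iff: "weak_run G p [] q \<longleftrightarrow> (p, q) \<in> (tau_steps G)\<^sup>*"
proof -
  have "observation t = [] \<longleftrightarrow> t \<in> lists {None}" for t :: "'a option list"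
    unfolding observation_def by (induction t) auto
  then show ?thesis unfolding weak_run_def run_tau_iff[symmetric] by blast
qed

lemma weak_run_tau_step:
  assumes "(p, r) \<in> tau_steps G" "weak_run G r s q"
  shows "weak_run G p s q"
proof -
  obtain t where "observation t = s" "run G r t q" using assms(2) weak_run_def by metis
  then have "observation (None # t) = s" "run G p (None # t) q"
    using assms(1) by (auto simp: observation_def tau_steps_def)
  then show ?thesis unfolding weak_run_def by blast
qed

text \<open>A run is cut at its first observable label: the \<tau>-prefix becomes the closure, and
  everything after the event, including later \<tau>-steps, stays in the weak run for
  \<open>s\<close>.\<close>

lemma weak_run_Cons_iff:
  "weak_run G p (\<sigma> # s) q \<longleftrightarrow>
    (\<exists>p' r. (p, p') \<in> (tau_steps G)\<^sup>* \<and> (p', Some \<sigma>, r) \<in> transitions G \<and> weak_run G r s q)"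
    (is "_ \<longleftrightarrow> ?R p")
proof
  assume "weak_run G p (\<sigma> # s) q"
  then obtain t where "observation t = \<sigma> # s" "run G p t q" unfolding weak_run_def by blast
  then show "?R p"
  proof (induction t arbitrary: p)
    case Nil
    then show ?case by (simp add: observation_def)
  next
    case (Cons a t)
    then obtain r where r: "(p, a, r) \<in> transitions G" "run G r t q" by auto
    show ?case
    proof (cases a)
      case None
      then have "?R r" using Cons r by (simp add: observation_def)
      moreover have "(p, r) \<in> tau_steps G" using r None by (simp add: tau_steps_def)
      ultimately show ?thesis by (meson converse_rtrancl_into_rtrancl)
    next
      case (Some b)
      then have "b = \<sigma>" "observation t = s" using Cons.prems by (auto simp: observation_def)
      then show ?thesis using r Some unfolding weak_run_def by blast
    qed
  qed
next
  assume "?R p"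
  then obtain p' r where tau: "(p, p') \<in> (tau_steps G)\<^sup>*"
    and r: "(p', Some \<sigma>, r) \<in> transitions G" "weak_run G r s q" by blast
  from r(2) obtain t where "observation t = s" "run G r t q" unfolding weak_run_def by blast
  then have "observation (Some \<sigma> # t) = \<sigma> # s" "run G p' (Some \<sigma> # t) q"
    using r(1) by (auto simp: observation_def)
  then have "weak_run G p' (\<sigma> # s) q" unfolding weak_run_def by blast
  with tau show "weak_run G p (\<sigma> # s) q"
    by (induction rule: converse_rtrancl_induct) (auto intro: weak_run_tau_step)
qed

text \<open>Cutting weak runs puts a closure before each event, whereas \<open>obs_succ\<close>
  closes after it. Starting from the closure of \<open>B\<close> aligns the two, and the induction
  hypothesis for the event image supplies the closure after the event.\<close>

lemma weak_run_image_eq_foldl: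
  "{q. \<exists>p\<in>B. weak_run G p s q} = foldl (obs_succ G) (unobservable_reach G B) s"
proof (induction s arbitrary: B)
  case Nil
  then show ?case by (auto simp: weak_run_Nil_iff unobservable_reach_eq_Image)
next
  case (Cons \<sigma> s)
  have "{q. \<exists>p\<in>B. weak_run G p (\<sigma> # s) q} =
      {q. \<exists>p\<in>event_image G (unobservable_reach G B) \<sigma>. weak_run G p s q}"
    unfolding weak_run_Cons_iff event_image_def unobservable_reach_eq_Image by blast
  then show ?case by (simp add: Cons.IH obs_succ_eq)
qed

section \<open>Unobservable reach in the composition\<close>

lemma sync_simps:
  "alphabet (sync n G) = (\<Union>i\<in>{1..n}. alphabet (G i))"
  "states (sync n G) = (\<Pi>\<^sub>E i\<in>{1..n}. states (G i))"
  "initials (sync n G) = (\<Pi>\<^sub>E i\<in>{1..n}. initials (G i))"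
  by (simp_all add: sync_def)

lemma sync_Some_iff:
  "(x, Some \<sigma>, y) \<in> transitions (sync n G) \<longleftrightarrow>
    x \<in> (\<Pi>\<^sub>E i\<in>{1..n}. states (G i)) \<and> y \<in> (\<Pi>\<^sub>E i\<in>{1..n}. states (G i)) \<and>
    \<sigma> \<in> alphabet (sync n G) \<and>
    (\<forall>i\<in>{1..n}. if \<sigma> \<in> alphabet (G i) then (x i, Some \<sigma>, y i) \<in> transitions (G i)
       else y i = x i)"
  by (simp add: sync_def)

lemma tau_steps_sync_iff:
  "(x, y) \<in> tau_steps (sync n G) \<longleftrightarrow>
    x \<in> (\<Pi>\<^sub>E i\<in>{1..n}. states (G i)) \<and> y \<in> (\<Pi>\<^sub>E i\<in>{1..n}. states (G i)) \<and>
    (\<exists>i\<in>{1..n}. (x i, y i) \<in> tau_steps (G i) \<and> (\<forall>j\<in>{1..n} - {i}. y j = x j))"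
  by (simp add: sync_def tau_steps_def)

lemma tau_steps_in_states:
  "wf_automaton G \<Longrightarrow> (p, q) \<in> tau_steps G \<Longrightarrow> p \<in> states G \<and> q \<in> states G"
  unfolding wf_automaton_def tau_steps_def by blast

text \<open>Projected to one component, a \<tau>-step of the composition is either a \<tau>-step or
  a pause.\<close>

lemma tau_reach_sync_component:
  assumes "(x, y) \<in> (tau_steps (sync n G))\<^sup>*" "i \<in> {1..n}"
  shows "(x i, y i) \<in> (tau_steps (G i))\<^sup>*"
  using assms(1)
proof (induction rule: rtrancl_induct)
  case (step y z)
  then obtain k where "(y k, z k) \<in> tau_steps (G k)" "\<forall>j\<in>{1..n} - {k}. z j = y j"
    unfolding tau_steps_sync_iff by blast
  then show ?case using step.IH assms(2) by (cases "i = k") auto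
qed simp

text \<open>While component \<open>i\<close> follows its \<tau>-path, the others wait. The
  intermediate tuples remain in the product of the state sets because \<tau>-steps of a well-formed
  automaton lead to states.\<close>

lemma tau_reach_sync_update:
  assumes wf: "wf_automaton (G i)" and i: "i \<in> {1..n}"
    and x: "x \<in> (\<Pi>\<^sub>E i\<in>{1..n}. states (G i))"
    and reach: "(x i, q) \<in> (tau_steps (G i))\<^sup>*"
  shows "(x, x(i := q)) \<in> (tau_steps (sync n G))\<^sup>*"
  using reach
proof (induction rule: rtrancl_induct)
  case (step q r)
  then have "q \<in> states (G i)" "r \<in> states (G i)" using tau_steps_in_states[OF wf] by auto
  then have upd: "x(i := q) \<in> (\<Pi>\<^sub>E i\<in>{1..n}. states (G i))"
      "x(i := r) \<in> (\<Pi>\<^sub>E i\<in>{1..n}. states (G i))"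
    using x i by (auto simp: PiE_iff extensional_def)
  have "(x(i := q), x(i := r)) \<in> tau_steps (sync n G)"
    unfolding tau_steps_sync_iff
  proof (intro conjI bexI[OF _ i] upd)
  qed (use step in auto)
  with step.IH show ?case by (rule rtrancl_into_rtrancl)
qed simp

text \<open>Since \<tau> is never shared, the components may travel to their targets one after the
  other.\<close>

lemma tau_reach_sync:
  assumes wf: "\<And>i. i \<in> {1..n} \<Longrightarrow> wf_automaton (G i)"
    and x: "x \<in> (\<Pi>\<^sub>E i\<in>{1..n}. states (G i))"
    and y: "y \<in> extensional {1..n}"
    and reach: "\<And>i. i \<in> {1..n} \<Longrightarrow> (x i, y i) \<in> (tau_steps (G i))\<^sup>*"
  shows "(x, y) \<in> (tau_steps (sync n G))\<^sup>*"
proof -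
  have y_st: "y i \<in> states (G i)" if "i \<in> {1..n}" for i
    using unobservable_reach_subset_states[OF wf[OF that], of "{x i}"] reach[OF that] x that
    by (auto simp: unobservable_reach_eq_Image PiE_iff)
  \<comment> \<open>\<open>override_on x y J\<close> is the tuple after the components in
    \<open>J\<close> have travelled; the induction on \<open>J\<close> lets one more component
    travel.\<close>
  have "(x, override_on x y J) \<in> (tau_steps (sync n G))\<^sup>*" if "finite J" "J \<subseteq> {1..n}" for J
    using that
  proof (induction rule: finite_induct)
    case (insert i J)
    let ?z = "override_on x y J"
    have i: "i \<in> {1..n}" using insert by blast
    have "?z \<in> (\<Pi>\<^sub>E i\<in>{1..n}. states (G i))"
      using x y y_st insert.prems by (auto simp: PiE_iff extensional_def override_on_def)
    moreover have "(?z i, y i) \<in> (tau_steps (G i))\<^sup>*"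
      using insert.hyps reach[OF i] by simp
    ultimately have "(?z, ?z(i := y i)) \<in> (tau_steps (sync n G))\<^sup>*"
      using tau_reach_sync_update[of G i n, OF wf[OF i] i] by blast
    moreover have "?z(i := y i) = override_on x y (insert i J)"
      by (auto simp: override_on_def)
    ultimately show ?case using insert.IH insert.prems by (auto intro: rtrancl_trans)
  qed simp
  then have "(x, override_on x y {1..n}) \<in> (tau_steps (sync n G))\<^sup>*" by blast
  moreover have "override_on x y {1..n} = y"
    using x y by (fastforce simp: override_on_def PiE_iff extensional_def)
  ultimately show ?thesis by simp
qed

text \<open>One inclusion is projection to the components; the other is sequential travel from
  starting points chosen componentwise.\<close>

lemma unobservable_reach_sync_PiE:
  assumes wf: "\<And>i. i \<in> {1..n} \<Longrightarrow> wf_automaton (G i)"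
    and B: "\<And>i. i \<in> {1..n} \<Longrightarrow> B i \<subseteq> states (G i)"
  shows "unobservable_reach (sync n G) (\<Pi>\<^sub>E i\<in>{1..n}. B i) =
    (\<Pi>\<^sub>E i\<in>{1..n}. unobservable_reach (G i) (B i))" (is "?L = ?R")
proof
  show "?L \<subseteq> ?R"
  proof
    fix y assume "y \<in> ?L"
    then obtain x where x: "x \<in> (\<Pi>\<^sub>E i\<in>{1..n}. B i)"
      and xy: "(x, y) \<in> (tau_steps (sync n G))\<^sup>*"
      unfolding unobservable_reach_eq_Image by blast
    \<comment> \<open>An empty path gives \<open>y = x\<close>; otherwise the last step ends in the
      product of the state sets.\<close>
    have "y \<in> extensional {1..n}"
      using xy x by cases (auto simp: tau_steps_sync_iff PiE_iff)
    then show "y \<in> ?R"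
      using x tau_reach_sync_component[OF xy] unfolding unobservable_reach_eq_Image PiE_iff by blast
  qed
next
  show "?R \<subseteq> ?L"
  proof
    fix y assume y: "y \<in> ?R"
    then have "\<forall>i\<in>{1..n}. \<exists>p. p \<in> B i \<and> (p, y i) \<in> (tau_steps (G i))\<^sup>*"
      unfolding unobservable_reach_eq_Image PiE_iff by blast
    then obtain f where f: "\<forall>i\<in>{1..n}. f i \<in> B i \<and> (f i, y i) \<in> (tau_steps (G i))\<^sup>*"
      by (rule bchoice[THEN exE])
    let ?x = "restrict f {1..n}"
    have x: "?x \<in> (\<Pi>\<^sub>E i\<in>{1..n}. B i)" using f by auto
    moreover from x have "?x \<in> (\<Pi>\<^sub>E i\<in>{1..n}. states (G i))"
      using B by (meson PiE_mono subsetD)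
    then have "(?x, y) \<in> (tau_steps (sync n G))\<^sup>*"
      using f y by (intro tau_reach_sync wf) (auto simp: PiE_iff)
    ultimately show "y \<in> ?L" unfolding unobservable_reach_eq_Image by blast
  qed
qed

section \<open>Observable successors in the composition\<close>

text \<open>This is a total form of the transition function of the composed estimators: a component
  that has \<sigma> in its alphabet but cannot follow it gets \<open>{}\<close> instead of blocking
  the step. The restricted lambda keeps results extensional, as states of \<open>sync\<close> must
  be.\<close>

definition sync_obs_succ ::
  "nat \<Rightarrow> (nat \<Rightarrow> ('e, 'q) automaton) \<Rightarrow> (nat \<Rightarrow> 'q set) \<Rightarrow> 'e \<Rightarrow> nat \<Rightarrow> 'q set" where
  "sync_obs_succ n G X \<sigma> =
    (\<lambda>i\<in>{1..n}. if \<sigma> \<in> alphabet (G i) then obs_succ (G i) (X i) \<sigma> else X i)"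

text \<open>Once \<sigma> is fixed, a synchronous step imposes no condition linking two components,
  so predecessors can be chosen independently.\<close>

lemma event_image_sync_PiE:
  assumes wf: "\<And>i. i \<in> {1..n} \<Longrightarrow> wf_automaton (G i)"
    and X: "\<And>i. i \<in> {1..n} \<Longrightarrow> X i \<subseteq> states (G i)"
    and \<sigma>: "\<sigma> \<in> alphabet (sync n G)"
  shows "event_image (sync n G) (\<Pi>\<^sub>E i\<in>{1..n}. X i) \<sigma> =
    (\<Pi>\<^sub>E i\<in>{1..n}. if \<sigma> \<in> alphabet (G i) then event_image (G i) (X i) \<sigma> else X i)"
    (is "?L = ?R")
proof
  show "?L \<subseteq> ?R"
  proof
    fix y assume "y \<in> ?L"
    then obtain x where x: "x \<in> (\<Pi>\<^sub>E i\<in>{1..n}. X i)"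
      and "(x, Some \<sigma>, y) \<in> transitions (sync n G)"
      unfolding event_image_def by blast
    then have "y \<in> extensional {1..n}"
      and step: "\<forall>i\<in>{1..n}. if \<sigma> \<in> alphabet (G i) then (x i, Some \<sigma>, y i) \<in> transitions (G i)
        else y i = x i"
      by (simp_all add: sync_Some_iff PiE_iff)
    moreover have "y i \<in> (if \<sigma> \<in> alphabet (G i) then event_image (G i) (X i) \<sigma> else X i)"
      if "i \<in> {1..n}" for i
      using step[rule_format, OF that] PiE_mem[OF x that] by (auto simp: event_image_def)
    ultimately show "y \<in> ?R" unfolding PiE_iff by blast
  qed
next
  show "?R \<subseteq> ?L"
  proof
    fix y assume y: "y \<in> ?R"
    have "\<forall>i\<in>{1..n}. \<exists>p. p \<in> X i \<and>
        (if \<sigma> \<in> alphabet (G i) then (p, Some \<sigma>, y i) \<in> transitions (G i) else y i = p)"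
    proof
      fix i assume "i \<in> {1..n}"
      from PiE_mem[OF y this] show "\<exists>p. p \<in> X i \<and>
          (if \<sigma> \<in> alphabet (G i) then (p, Some \<sigma>, y i) \<in> transitions (G i) else y i = p)"
        by (auto simp: event_image_def split: if_splits)
    qed
    then obtain f where f: "\<forall>i\<in>{1..n}. f i \<in> X i \<and>
        (if \<sigma> \<in> alphabet (G i) then (f i, Some \<sigma>, y i) \<in> transitions (G i) else y i = f i)"
      by (rule bchoice[THEN exE])
    let ?x = "restrict f {1..n}"
    have x: "?x \<in> (\<Pi>\<^sub>E i\<in>{1..n}. X i)" using f by auto
    have "?x \<in> (\<Pi>\<^sub>E i\<in>{1..n}. states (G i))" using x X by (meson PiE_mono subsetD)
    moreover have "y \<in> (\<Pi>\<^sub>E i\<in>{1..n}. states (G i))"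
    proof (rule PiE_I)
      fix i assume i: "i \<in> {1..n}"
      then have "y i \<in> (if \<sigma> \<in> alphabet (G i) then event_image (G i) (X i) \<sigma> else X i)"
        using y by blast
      then show "y i \<in> states (G i)"
        using X[OF i] event_image_subset_states[OF wf[OF i]] by (metis subsetD)
    qed (use y in \<open>auto simp: PiE_iff extensional_def\<close>)
    ultimately have "(?x, Some \<sigma>, y) \<in> transitions (sync n G)"
      using f \<sigma> by (simp add: sync_Some_iff)
    with x show "y \<in> ?L" unfolding event_image_def by blast
  qed
qed

text \<open>After \<sigma>, \<tau>-steps may also occur in components whose alphabet lacks \<sigma>.
  Closedness of \<open>X i\<close> ensures that these leave the waiting estimate unchanged.\<close>

lemma obs_succ_sync_PiE:
  assumes wf: "\<And>i. i \<in> {1..n} \<Longrightarrow> wf_automaton (G i)"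
    and X: "\<And>i. i \<in> {1..n} \<Longrightarrow> X i \<subseteq> states (G i)"
    and closed: "\<And>i. i \<in> {1..n} \<Longrightarrow> unobservable_reach (G i) (X i) = X i"
    and \<sigma>: "\<sigma> \<in> alphabet (sync n G)"
  shows "obs_succ (sync n G) (\<Pi>\<^sub>E i\<in>{1..n}. X i) \<sigma> =
    (\<Pi>\<^sub>E i\<in>{1..n}. sync_obs_succ n G X \<sigma> i)"
proof -
  have "obs_succ (sync n G) (\<Pi>\<^sub>E i\<in>{1..n}. X i) \<sigma> =
      (\<Pi>\<^sub>E i\<in>{1..n}. unobservable_reach (G i)
        (if \<sigma> \<in> alphabet (G i) then event_image (G i) (X i) \<sigma> else X i))"
    unfolding obs_succ_eq
    by (subst event_image_sync_PiE; (subst unobservable_reach_sync_PiE)?)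
      (use wf X \<sigma> event_image_subset_states[OF wf] in auto)
  also have "\<dots> = (\<Pi>\<^sub>E i\<in>{1..n}. sync_obs_succ n G X \<sigma> i)"
    by (intro PiE_cong) (auto simp: sync_obs_succ_def obs_succ_eq closed)
  finally show ?thesis .
qed

text \<open>The one-step product formula can be iterated because \<open>sync_obs_succ\<close>
  preserves its two invariants: the factors consist of states and are closed under \<tau>.\<close>

lemma foldl_obs_succ_sync_PiE:
  assumes wf: "\<And>i. i \<in> {1..n} \<Longrightarrow> wf_automaton (G i)"
    and "s \<in> lists (alphabet (sync n G))"
    and "\<And>i. i \<in> {1..n} \<Longrightarrow> X i \<subseteq> states (G i)"
    and "\<And>i. i \<in> {1..n} \<Longrightarrow> unobservable_reach (G i) (X i) = X i"
  shows "foldl (obs_succ (sync n G)) (\<Pi>\<^sub>E i\<in>{1..n}. X i) s =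
    (\<Pi>\<^sub>E i\<in>{1..n}. foldl (sync_obs_succ n G) X s i)"
  using assms(2-)
proof (induction s arbitrary: X rule: list.induct)
  case (Cons \<sigma> s)
  let ?Y = "sync_obs_succ n G X \<sigma>"
  have "?Y i \<subseteq> states (G i)" if "i \<in> {1..n}" for i
    using that Cons.prems(2)[OF that]
      unobservable_reach_subset_states[OF wf event_image_subset_states[OF wf], OF that that]
    by (auto simp: sync_obs_succ_def obs_succ_eq)
  moreover have "unobservable_reach (G i) (?Y i) = ?Y i" if "i \<in> {1..n}" for i
    using that Cons.prems(3)[OF that]
    by (simp add: sync_obs_succ_def obs_succ_eq unobservable_reach_idem)
  moreover have "obs_succ (sync n G) (\<Pi>\<^sub>E i\<in>{1..n}. X i) \<sigma> = (\<Pi>\<^sub>E i\<in>{1..n}. ?Y i)"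
    using Cons.prems by (intro obs_succ_sync_PiE wf) auto
  ultimately show ?case using Cons.IH[of ?Y] Cons.prems(1) by simp
qed simp

section \<open>Runs of the composed estimators\<close>

lemma det_simps:
  "alphabet (det G) = alphabet G"
  "states (det G) = obs_states G"
  "initials (det G) = {unobservable_reach G (initials G)} - {{}}"
  "(X, Some \<sigma>, Y) \<in> transitions (det G) \<longleftrightarrow>
    X \<in> obs_states G \<and> \<sigma> \<in> alphabet G \<and> Y = obs_succ G X \<sigma> \<and> Y \<noteq> {}"
  by (auto simp: det_def)

lemma obs_states_nonempty: "X \<in> obs_states G \<Longrightarrow> X \<noteq> {}"
  by (induction rule: obs_states.induct) auto

lemma alphabet_sync_det: "alphabet (sync n (\<lambda>i. det (G i))) = alphabet (sync n G)"
  by (simp add: sync_simps det_simps)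

text \<open>Determinism fixes the target. For an event of the alphabet, emptiness is the only
  obstruction: nonempty successors are estimator states again, and waiting components already hold
  one.\<close>

lemma sync_det_Some_iff:
  assumes X: "X \<in> (\<Pi>\<^sub>E i\<in>{1..n}. obs_states (G i))"
  shows "(X, Some \<sigma>, Y) \<in> transitions (sync n (\<lambda>i. det (G i))) \<longleftrightarrow>
    \<sigma> \<in> alphabet (sync n G) \<and> Y = sync_obs_succ n G X \<sigma> \<and> (\<forall>i\<in>{1..n}. Y i \<noteq> {})"
    (is "?L \<longleftrightarrow> ?R")
proof
  assume ?L
  then have Y: "Y \<in> (\<Pi>\<^sub>E i\<in>{1..n}. obs_states (G i))" and \<sigma>: "\<sigma> \<in> alphabet (sync n G)"
    and step: "\<forall>i\<in>{1..n}. Y i = (if \<sigma> \<in> alphabet (G i) then obs_succ (G i) (X i) \<sigma> else X i)"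
    by (auto simp: sync_Some_iff det_simps alphabet_sync_det split: if_splits)
  have "Y = sync_obs_succ n G X \<sigma>"
    using step Y by (intro extensionalityI[of _ "{1..n}"]) (auto simp: sync_obs_succ_def PiE_iff)
  moreover have "\<forall>i\<in>{1..n}. Y i \<noteq> {}" using Y obs_states_nonempty by fast
  ultimately show ?R using \<sigma> by blast
next
  assume R: ?R
  then have Y_ne: "\<forall>i\<in>{1..n}. Y i \<noteq> {}" by blast
  have Y_eq: "Y i = (if \<sigma> \<in> alphabet (G i) then obs_succ (G i) (X i) \<sigma> else X i)"
    if "i \<in> {1..n}" for i
    using R that by (simp add: sync_obs_succ_def)
  have "Y i \<in> obs_states (G i)" if "i \<in> {1..n}" for i
    using Y_eq[OF that] bspec[OF Y_ne that] PiE_mem[OF X that] by (auto intro: obs_states.step)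
  then have "Y \<in> (\<Pi>\<^sub>E i\<in>{1..n}. obs_states (G i))"
    using R by (auto simp: sync_obs_succ_def PiE_iff)
  moreover have "if \<sigma> \<in> alphabet (G i) then (X i, Some \<sigma>, Y i) \<in> transitions (det (G i))
      else Y i = X i" if "i \<in> {1..n}" for i
    using Y_eq[OF that] bspec[OF Y_ne that] PiE_mem[OF X that] by (auto simp: det_simps)
  ultimately show ?L
    using R X unfolding sync_Some_iff alphabet_sync_det det_simps(1,2) by blast
qed

text \<open>An empty estimate stays empty whether its component moves or waits. Hence a final tuple
  without empty factors rules out blocking at any earlier step.\<close>

lemma foldl_sync_obs_succ_empty:
  "i \<in> {1..n} \<Longrightarrow> X i = {} \<Longrightarrow> foldl (sync_obs_succ n G) X s i = {}"
  by (induction s arbitrary: X) (auto simp: sync_obs_succ_def obs_succ_empty)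

lemma run_sync_det_iff:
  assumes "X \<in> (\<Pi>\<^sub>E i\<in>{1..n}. obs_states (G i))"
  shows "run (sync n (\<lambda>i. det (G i))) X (map Some s) Y \<longleftrightarrow>
    s \<in> lists (alphabet (sync n G)) \<and> Y = foldl (sync_obs_succ n G) X s \<and>
    (\<forall>i\<in>{1..n}. Y i \<noteq> {})"
  using assms
proof (induction s arbitrary: X)
  case Nil
  then show ?case using obs_states_nonempty by fastforce
next
  case (Cons \<sigma> s)
  let ?Z = "sync_obs_succ n G X \<sigma>"
  show ?case
  proof (cases "\<sigma> \<in> alphabet (sync n G) \<and> (\<forall>i\<in>{1..n}. ?Z i \<noteq> {})")
    case True
    then have tr: "(X, Some \<sigma>, ?Z) \<in> transitions (sync n (\<lambda>i. det (G i)))"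
      using sync_det_Some_iff[OF Cons.prems] by blast
    then have "?Z \<in> (\<Pi>\<^sub>E i\<in>{1..n}. obs_states (G i))"
      by (simp add: sync_Some_iff det_simps)
    then show ?thesis using Cons.IH[of ?Z] True by (simp add: sync_det_Some_iff[OF Cons.prems])
  next
    \<comment> \<open>Neither side can hold: no transition leads from \<open>X\<close> under
      \<sigma>, while the right side fails by the alphabet condition or by persistence of an empty
      factor.\<close>
    case False
    then show ?thesis
      using foldl_sync_obs_succ_empty[of _ n ?Z G s] by (auto simp: sync_det_Some_iff[OF Cons.prems])
  qed
qed

section \<open>Opacity expressed by componentwise estimates\<close>

theorem theorem2:
  fixes n :: nat
    and G :: "nat \<Rightarrow> ('e, 'q) automaton"
    and S :: "nat \<Rightarrow> 'q set"
  assumes "\<And>i. i \<in> {1..n} \<Longrightarrow> wf_automaton (G i)"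
    and "\<And>i. i \<in> {1..n} \<Longrightarrow> S i \<subseteq> states (G i)"
  shows "current_state_opaque (sync n G) (secret_or n G S) \<longleftrightarrow>
    (\<forall>s X. (\<exists>X0 \<in> initials (sync n (\<lambda>i. det (G i))).
              run (sync n (\<lambda>i. det (G i))) X0 (map Some s) X) \<longrightarrow>
           (\<forall>i\<in>{1..n}. \<not> X i \<subseteq> S i))"
proof -
  let ?\<Sigma> = "lists (alphabet (sync n G))"
  \<comment> \<open>A factor of \<open>X0\<close> is empty if its automaton has no initial state;
    the composed estimators then have no initial state either, but \<open>E\<close> remains
    defined.\<close>
  define X0 where "X0 = (\<lambda>i\<in>{1..n}. unobservable_reach (G i) (initials (G i)))"
  define E where "E s = foldl (sync_obs_succ n G) X0 s" for s
  define R where "R s = {q. \<exists>p\<in>initials (sync n G). weak_run (sync n G) p s q}" for s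
  define NS where "NS = (\<Pi>\<^sub>E i\<in>{1..n}. states (G i) - S i)"
  have ini: "initials (G i) \<subseteq> states (G i)" if "i \<in> {1..n}" for i
    using assms(1)[OF that] by (simp add: wf_automaton_def)
  have R_eq: "R s = (\<Pi>\<^sub>E i\<in>{1..n}. E s i)" if "s \<in> ?\<Sigma>" for s
  proof -
    have "unobservable_reach (sync n G) (initials (sync n G)) = (\<Pi>\<^sub>E i\<in>{1..n}. X0 i)"
      unfolding sync_simps
      by (subst unobservable_reach_sync_PiE)
        (use assms(1) ini in \<open>auto simp: X0_def intro!: PiE_cong\<close>)
    moreover have "X0 i \<subseteq> states (G i)" if "i \<in> {1..n}" for i
      using that unobservable_reach_subset_states[OF assms(1) ini, OF that that]
      by (simp add: X0_def)
    moreover have "unobservable_reach (G i) (X0 i) = X0 i" if "i \<in> {1..n}" for i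
      using that by (simp add: X0_def unobservable_reach_idem)
    ultimately show ?thesis
      unfolding R_def E_def weak_run_image_eq_foldl
      using foldl_obs_succ_sync_PiE[of n G s X0, OF assms(1) that] by simp
  qed
  have wf: "wf_automaton (sync n G)" using assms(1) by (rule wf_sync)
  then have "initials (sync n G) \<subseteq> states (sync n G)" by (simp add: wf_automaton_def)
  then have R_st: "R s \<subseteq> states (sync n G)" for s
    using run_in_states[OF wf] unfolding R_def weak_run_def by blast
  have NS_st: "NS \<subseteq> states (sync n G)" unfolding NS_def sync_simps by (intro PiE_mono) blast
  have secret: "secret_or n G S = states (sync n G) - NS"
    by (simp add: secret_or_def NS_def sync_simps)
  \<comment> \<open>Opacity never relates the two initial states to each other, so the quantifiers
    over them can be absorbed into \<open>R s\<close>. A secret endpoint already witnesses that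
    \<open>s\<close> is in the language.\<close>
  have "current_state_opaque (sync n G) (secret_or n G S) \<longleftrightarrow>
      (\<forall>s\<in>?\<Sigma>. R s \<inter> secret_or n G S \<noteq> {} \<longrightarrow> R s \<inter> (states (sync n G) - secret_or n G S) \<noteq> {})"
    unfolding current_state_opaque_def language_def R_def by blast
  \<comment> \<open>A nonempty \<open>R s\<close> that avoids the secret states lies within
    \<open>NS\<close>, so the premise may be replaced by nonemptiness.\<close>
  also have "\<dots> \<longleftrightarrow> (\<forall>s\<in>?\<Sigma>. R s \<noteq> {} \<longrightarrow> R s \<inter> NS \<noteq> {})"
    using R_st NS_st unfolding secret by blast
  also have "\<dots> \<longleftrightarrow> (\<forall>s\<in>?\<Sigma>. (\<forall>i\<in>{1..n}. E s i \<noteq> {}) \<longrightarrow> (\<forall>i\<in>{1..n}. \<not> E s i \<subseteq> S i))"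
  proof (intro ball_cong refl)
    fix s assume s: "s \<in> ?\<Sigma>"
    have ne: "R s \<noteq> {} \<longleftrightarrow> (\<forall>i\<in>{1..n}. E s i \<noteq> {})"
      unfolding R_eq[OF s] by (auto simp: PiE_eq_empty_iff)
    have "E s i \<inter> (states (G i) - S i) \<noteq> {} \<longleftrightarrow> \<not> E s i \<subseteq> S i"
      if "R s \<noteq> {}" "i \<in> {1..n}" for i
    proof -
      \<comment> \<open>An inclusion of products passes to the factors when the smaller product is
        nonempty, which is where \<open>R s \<noteq> {}\<close> enters.\<close>
      have "E s i \<subseteq> states (G i)"
        using R_st[of s] that unfolding sync_simps R_eq[OF s]
        by (auto simp: subset_PiE)
      then show ?thesis by blast
    qed
    \<comment> \<open>Intersections of products are taken factorwise, and a product is nonempty iff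
      every factor is.\<close>
    then have "R s \<inter> NS \<noteq> {} \<longleftrightarrow> (\<forall>i\<in>{1..n}. \<not> E s i \<subseteq> S i)" if "R s \<noteq> {}"
      using that unfolding NS_def R_eq[OF s] PiE_Int by (simp add: PiE_eq_empty_iff)
    then show "(R s \<noteq> {} \<longrightarrow> R s \<inter> NS \<noteq> {}) \<longleftrightarrow>
        ((\<forall>i\<in>{1..n}. E s i \<noteq> {}) \<longrightarrow> (\<forall>i\<in>{1..n}. \<not> E s i \<subseteq> S i))"
      using ne by blast
  qed
  \<comment> \<open>The variable \<open>X\<close> stands for the tuple \<open>E s\<close>, giving
    the form in which determinism identifies it with the endpoint of a run.\<close>
  also have "\<dots> \<longleftrightarrow> (\<forall>s X. s \<in> ?\<Sigma> \<and> X = E s \<and> (\<forall>i\<in>{1..n}. X i \<noteq> {}) \<longrightarrow>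
      (\<forall>i\<in>{1..n}. \<not> X i \<subseteq> S i))"
    by blast
  also have "\<dots> \<longleftrightarrow> (\<forall>s X. (\<exists>X0 \<in> initials (sync n (\<lambda>i. det (G i))).
              run (sync n (\<lambda>i. det (G i))) X0 (map Some s) X) \<longrightarrow>
           (\<forall>i\<in>{1..n}. \<not> X i \<subseteq> S i))"
  proof -
    have init: "Z \<in> initials (sync n (\<lambda>i. det (G i))) \<longleftrightarrow> Z = X0 \<and> (\<forall>i\<in>{1..n}. X0 i \<noteq> {})" for Z
    proof -
      have "Z \<in> initials (sync n (\<lambda>i. det (G i))) \<longleftrightarrow>
          Z \<in> extensional {1..n} \<and> (\<forall>i\<in>{1..n}. Z i = X0 i \<and> X0 i \<noteq> {})"
        by (auto simp: sync_simps det_simps PiE_iff X0_def)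
      moreover have "X0 \<in> extensional {1..n}" by (simp add: X0_def)
      ultimately show ?thesis by (metis extensionalityI)
    qed
    have obs: "X0 \<in> (\<Pi>\<^sub>E i\<in>{1..n}. obs_states (G i))" if "\<forall>i\<in>{1..n}. X0 i \<noteq> {}"
      using that by (auto simp: X0_def intro: obs_states.initial)
    have "(\<exists>X0 \<in> initials (sync n (\<lambda>i. det (G i))).
        run (sync n (\<lambda>i. det (G i))) X0 (map Some s) X) \<longleftrightarrow>
        s \<in> ?\<Sigma> \<and> X = E s \<and> (\<forall>i\<in>{1..n}. X i \<noteq> {})" for s X
    proof (cases "\<forall>i\<in>{1..n}. X0 i \<noteq> {}")
      case True
      then have "initials (sync n (\<lambda>i. det (G i))) = {X0}" using init by blast
      then show ?thesis unfolding E_def using run_sync_det_iff[OF obs[OF True]] by simp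
    next
      \<comment> \<open>The composed estimators have no initial state, and the empty factor of
        \<open>X0\<close> persists in \<open>E s\<close>, so both sides fail.\<close>
      case False
      then obtain i where "i \<in> {1..n}" "E s i = {}"
        using foldl_sync_obs_succ_empty[of _ n X0 G s] unfolding E_def by blast
      with False show ?thesis using init by blast
    qed
    then show ?thesis by simp
  qed
  finally show ?thesis .
qed

end
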